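(* Consider the game, the mixing matrix $W$ and Algorithm 1 described in the context, and suppose that: (1) for every $i\in[n]$, $\Omega_i\subseteq\mathbb{R}$ is convex and closed, and $J_i(x_i,x_{-i})$ is convex and continuously differentiable in $x_i$ for each fixed $x_{-i}$; (2) each $\Omega_i$, $i\in[n]$, is bounded; (3) for every $i\in[n]$ there are constants $L_i,L_{-i}\ge 0$ such that $|\nabla_iJ_i(x_i,x_{-i})-\nabla_iJ_i(y_i,x_{-i})|\le L_i|x_i-y_i|$ for all $x_i,y_i\in\Omega_i$ and $x_{-i}\in\mathbb{R}^{n-1}$, and $|\nabla_iJ_i(x_i,x_{-i})-\nabla_iJ_i(x_i,y_{-i})|\le L_{-i}\|x_{-i}-y_{-i}\|$ for all $x_i\in\Omega_i$ and $x_{-i},y_{-i}\in\mathbb{R}^{n-1}$; put $L=\max_{i\in[n]}\sqrt{L_i^2+L_{-i}^2}$; (4) the communication graph is connected, and $W=[w_{ij}]\in\mathbb{R}^{n\times n}$ is a non-negative symmetric matrix with $w_{ij}>0$ if and only if $\{i,j\}\in\mathcal{A}$ and $\sum_{j=1}^n w_{ij}=1$ for all $i\in[n]$. Assume that the pseudo-gradient $F$ is monotone over $\mathbb{R}^n$, i.e. $\langle F(x)-F(y),x-y\rangle\ge 0$ for all $x,y\in\mathbb{R}^n$. Let the parameters of Algorithm 1 be $$\alpha_k=\frac{A}{(k+1)^a},\qquad \lambda_k=\left(\frac{k}{k+1}\right)^{a+b},$$ where $a,b>0$, $a>1/2$, $a+b<1$ and $0<A<\frac{1}{2L}\,\frac{1}{2^{a+b/2}}$.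 Let $\theta_t=\frac{1}{(t+1)^b}$ and $$\bar x^k=\frac{\sum_{t=1}^k\theta_t\alpha_t\,x^{t+1}}{\sum_{t=1}^k\theta_t\alpha_t},$$ where $x^{t}=\mathrm{diag}(\mathbf{x}^t)$ is the joint action at iteration $t$ of the algorithm. Then $$\max_{x\in\Omega}\langle F(x),\bar x^k-x\rangle=O\left(\frac{1}{(k+1)^{1-a-b}}\right).$$
   Context: Game. There are $n$ players, $[n]=\{1,\dots,n\}$. Player $i$ has action set $\Omega_i\subseteq\mathbb{R}$ and cost function $J_i(x_i,x_{-i})$ defined on $\mathbb{R}^n$, with $x_i$ the player's own action and $x_{-i}$ the vector of the other players' actions. $\Omega=\Omega_1\times\cdots\times\Omega_n$. $\nabla_i$ denotes the partial derivative with respect to $x_i$. The pseudo-gradient is $F(x)=[\nabla_1J_1(x),\dots,\nabla_nJ_n(x)]^T\in\mathbb{R}^n$. Players communicate over an undirected graph with node set $[n]$ and arc set $\mathcal{A}$, with an associated mixing matrix $W$. The second largest singular value $\sigma$ of $W$ satisfies $\sigma\in(0,1)$. Norms. On $\mathbb{R}^n$: Euclidean inner product and norm. On $\mathbb{R}^{n\times n}$: Frobenius inner product $\langle u,v\rangle=\mathrm{trace}(u^Tv)$ and Frobenius norm. Estimation matrices. Each player $i$ holds a vector $x_{(i)}\in\mathbb{R}^n$ whose $i$-th entry is its own action $x_i$ and whose other entries are estimates of the other players' actions. $\mathbf{x}\in\mathbb{R}^{n\times n}$ is the matrix whose $i$-th row is $x_{(i)}^T$. $\mathrm{diag}(\mathbf{x})\in\mathbb{R}^n$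 is the vector of diagonal entries, i.e. the joint action. $\Omega_a=\{\mathbf{x}\in\mathbb{R}^{n\times n}:\mathrm{diag}(\mathbf{x})\in\Omega\}$. $\mathbf{F}(\mathbf{x})$ is the diagonal $n\times n$ matrix with diagonal entries $\nabla_iJ_i(x_{(i)})$, $i=1,\dots,n$. Algorithm 1 (with step sizes $\alpha_k>0$ and parameters $\lambda_k>0$). Pick an arbitrary $\mathbf{x}^0\in\Omega_a$, set $\hat{\mathbf{x}}^0=W\mathbf{x}^0$ and $\mathbf{x}^1=\hat{\mathbf{x}}^0$. For $k=1,2,\dots$: $\hat{\mathbf{x}}^k=W\mathbf{x}^k$ and $$\mathbf{x}^{k+1}=\mathcal{P}_{\Omega_a}\left\{\hat{\mathbf{x}}^k-\alpha_k\left(\mathbf{F}(\hat{\mathbf{x}}^k)+\lambda_k(\mathbf{F}(\mathbf{x}^k)-\mathbf{F}(\hat{\mathbf{x}}^{k-1}))\right)\right\},$$ where $\mathcal{P}_{\Omega_a}$ is the (Frobenius-norm) projection onto $\Omega_a$. *)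

theory Defs
  imports
    "HOL-Analysis.Analysis"
    "HOL-Library.Multiset"
    "HOL-Library.More_List"
    "HOL-Library.Landau_Symbols"
begin

section \<open>The game\<close>

text \<open>Players are the elements of a finite type \<open>'n\<close>. The pair of an own action \<open>t\<close> and the
  opponents' actions \<open>x\<^sub>-\<^sub>i\<close> is encoded as \<open>set_action i t x\<close>, in which the \<open>i\<close>-th coordinate
  of \<open>x\<close> is irrelevant; thus ranging over all \<open>x\<close> is ranging over all \<open>x\<^sub>-\<^sub>i\<close>.\<close>

definition set_action :: "'n \<Rightarrow> real \<Rightarrow> real^'n \<Rightarrow> real^'n" where
  "set_action i t x = (\<chi> j. if j = i then t else x $ j)"

definition partial_cost :: "('n \<Rightarrow> real^'n \<Rightarrow> real) \<Rightarrow> 'n \<Rightarrow> real^'n \<Rightarrow> real" where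
  "partial_cost J i x = deriv (\<lambda>t. J i (set_action i t x)) (x $ i)"

definition pseudo_gradient :: "('n \<Rightarrow> real^'n \<Rightarrow> real) \<Rightarrow> real^'n \<Rightarrow> real^'n" where
  "pseudo_gradient J x = (\<chi> i. partial_cost J i x)"

definition joint_actions :: "('n \<Rightarrow> real set) \<Rightarrow> (real^'n) set" where
  "joint_actions \<Omega> = {x. \<forall>i. x $ i \<in> \<Omega> i}"

definition own_lipschitz ::
  "('n \<Rightarrow> real^'n \<Rightarrow> real) \<Rightarrow> ('n \<Rightarrow> real set) \<Rightarrow> 'n \<Rightarrow> real \<Rightarrow> bool" where
  "own_lipschitz J \<Omega> i l \<longleftrightarrow>
     (\<forall>s\<in>\<Omega> i. \<forall>t\<in>\<Omega> i. \<forall>x.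
        \<bar>partial_cost J i (set_action i s x) - partial_cost J i (set_action i t x)\<bar>
          \<le> l * \<bar>s - t\<bar>)"

definition others_lipschitz ::
  "('n::finite \<Rightarrow> real^'n \<Rightarrow> real) \<Rightarrow> ('n \<Rightarrow> real set) \<Rightarrow> 'n \<Rightarrow> real \<Rightarrow> bool" where
  "others_lipschitz J \<Omega> i l \<longleftrightarrow>
     (\<forall>t\<in>\<Omega> i. \<forall>x y.
        \<bar>partial_cost J i (set_action i t x) - partial_cost J i (set_action i t y)\<bar>
          \<le> l * L2_set (\<lambda>j. x $ j - y $ j) (- {i}))"

definition monotone_operator :: "('a::real_inner \<Rightarrow> 'a) \<Rightarrow> bool" where
  "monotone_operator F \<longleftrightarrow> (\<forall>x y. 0 \<le> (F x - F y) \<bullet> (x - y))"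

section \<open>Communication graph and mixing matrix\<close>

text \<open>Arcs of an undirected graph are sets \<open>{i, j}\<close>. Self-loops are neither required nor
  forbidden, so that the diagonal entries of a mixing matrix may be positive.\<close>

definition undirected_graph :: "'n set set \<Rightarrow> bool" where
  "undirected_graph E \<longleftrightarrow> (\<forall>e\<in>E. \<exists>i j. e = {i, j})"

definition graph_connected :: "'n set set \<Rightarrow> bool" where
  "graph_connected E \<longleftrightarrow> (\<forall>i j. (i, j) \<in> {(u, v). {u, v} \<in> E}\<^sup>*)"

definition mixing_matrix :: "'n::finite set set \<Rightarrow> real^'n^'n \<Rightarrow> bool" where
  "mixing_matrix E W \<longleftrightarrow>
     (\<forall>i j. 0 \<le> W $ i $ j) \<and> transpose W = W \<and>
     (\<forall>i j. 0 < W $ i $ j \<longleftrightarrow> {i, j} \<in> E) \<and>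
     (\<forall>i. (\<Sum>j\<in>UNIV. W $ i $ j) = 1)"

text \<open>Singular values are the square roots of the eigenvalues of \<open>M\<^sup>T M\<close>, listed in decreasing
  order and repeated according to multiplicity (the dimension of the eigenspace, which is the
  algebraic multiplicity because \<open>M\<^sup>T M\<close> is symmetric).\<close>

definition gram_eigenspace :: "real^'n^'n \<Rightarrow> real \<Rightarrow> (real^'n) set" where
  "gram_eigenspace M c = {v. (transpose M ** M) *v v = c *\<^sub>R v}"

definition singular_value_set :: "real^'n^'n \<Rightarrow> real set" where
  "singular_value_set M = {s. 0 \<le> s \<and> (\<exists>v\<in>gram_eigenspace M (s\<^sup>2). v \<noteq> 0)}"

definition singular_values :: "real^'n^'n \<Rightarrow> real list" where
  "singular_values M =
     rev (sorted_list_of_multiset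
       (\<Sum>s\<in>singular_value_set M. replicate_mset (dim (gram_eigenspace M (s\<^sup>2))) s))"

text \<open>List positions start at 0. A \<open>1 \<times> 1\<close> matrix has no second singular value, and gets 0.\<close>

definition second_singular_value :: "real^'n^'n \<Rightarrow> real" where
  "second_singular_value M = nth_default 0 (singular_values M) 1"

text \<open>The sum in the definition of \<^const>\<open>singular_values\<close> ranges over a finite set, so it is
  not the default value 0.\<close>

lemma finite_singular_value_set:
  fixes M :: "real^'n^'n"
  shows "finite (singular_value_set M)"
proof -
  define G where "G = transpose M ** M"
  have sym: "(G *v x) \<bullet> y = x \<bullet> (G *v y)" for x y
    unfolding G_def
    by (metis dot_lmul_matrix inner_commute matrix_transpose_mul transpose_matrix_vector
        transpose_transpose)
  have "\<forall>s\<in>singular_value_set M. \<exists>v. v \<noteq> 0 \<and> G *v v = s\<^sup>2 *\<^sub>R v"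
    by (auto simp: singular_value_set_def gram_eigenspace_def G_def)
  then obtain v where v: "\<And>s. s \<in> singular_value_set M \<Longrightarrow> v s \<noteq> 0 \<and> G *v v s = s\<^sup>2 *\<^sub>R v s"
    by metis
  have orth: "v s \<bullet> v t = 0"
    if "s \<in> singular_value_set M" "t \<in> singular_value_set M" "s \<noteq> t" for s t
  proof -
    have "s\<^sup>2 * (v s \<bullet> v t) = t\<^sup>2 * (v s \<bullet> v t)"
      using sym[of "v s" "v t"] v[OF that(1)] v[OF that(2)] by simp
    moreover have "s\<^sup>2 \<noteq> t\<^sup>2"
      using that by (auto simp: singular_value_set_def power2_eq_iff_nonneg)
    ultimately show ?thesis by simp
  qed
  have inj: "inj_on v (singular_value_set M)"
    by (rule inj_onI) (metis orth v inner_eq_zero_iff)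
  have "pairwise orthogonal (v ` singular_value_set M)"
    unfolding pairwise_def orthogonal_def using orth by blast
  then have "finite (v ` singular_value_set M)"
    by (rule pairwise_orthogonal_imp_finite)
  with inj show ?thesis
    by (simp add: finite_image_iff)
qed

section \<open>The algorithm\<close>

definition diag_vec :: "real^'n^'n \<Rightarrow> real^'n" where
  "diag_vec X = (\<chi> i. X $ i $ i)"

definition estimation_set :: "('n \<Rightarrow> real set) \<Rightarrow> (real^'n^'n) set" where
  "estimation_set \<Omega> = {X. diag_vec X \<in> joint_actions \<Omega>}"

text \<open>\<open>X $ i\<close> is the \<open>i\<close>-th row of \<open>X\<close>, i.e. the vector held by player \<open>i\<close>.\<close>

definition gradient_matrix :: "('n \<Rightarrow> real^'n \<Rightarrow> real) \<Rightarrow> real^'n^'n \<Rightarrow> real^'n^'n" where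
  "gradient_matrix J X = (\<chi> i j. if i = j then partial_cost J i (X $ i) else 0)"

text \<open>\<open>norm\<close> and inner product of \<open>real^'n^'n\<close> are the Frobenius norm and inner product, so
  \<^const>\<open>closest_point\<close> is the Frobenius projection.\<close>

definition algorithm_run ::
  "('n::finite \<Rightarrow> real^'n \<Rightarrow> real) \<Rightarrow> ('n \<Rightarrow> real set) \<Rightarrow> real^'n^'n \<Rightarrow>
   (nat \<Rightarrow> real) \<Rightarrow> (nat \<Rightarrow> real) \<Rightarrow> (nat \<Rightarrow> real^'n^'n) \<Rightarrow> (nat \<Rightarrow> real^'n^'n) \<Rightarrow> bool" where
  "algorithm_run J \<Omega> W \<alpha> \<mu> X Xhat \<longleftrightarrow>
     X 0 \<in> estimation_set \<Omega> \<and>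
     (\<forall>k. Xhat k = W ** X k) \<and>
     X 1 = Xhat 0 \<and>
     (\<forall>k\<ge>1. X (k + 1) = closest_point (estimation_set \<Omega>)
        (Xhat k - \<alpha> k *\<^sub>R (gradient_matrix J (Xhat k)
           + \<mu> k *\<^sub>R (gradient_matrix J (X k) - gradient_matrix J (Xhat (k - 1))))))"

definition weighted_average ::
  "(nat \<Rightarrow> real) \<Rightarrow> (nat \<Rightarrow> real) \<Rightarrow> (nat \<Rightarrow> real^'n^'n) \<Rightarrow> nat \<Rightarrow> real^'n" where
  "weighted_average \<theta> \<alpha> X k =
     (\<Sum>t=1..k. (\<theta> t * \<alpha> t) *\<^sub>R diag_vec (X (t + 1))) /\<^sub>R (\<Sum>t=1..k. \<theta> t * \<alpha> t)"

end

theory Submission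
  imports Defs
begin

text \<open>
  Multiplying the projection inequality of step \<open>k\<close> by \<open>\<theta>\<^sub>k\<close> and summing, the squared distances to
  a consensus matrix telescope because \<open>\<theta>\<close> decreases, and the correction terms
  \<open>F(x\<^sup>k) - F(Wx\<^sup>k\<^sup>-\<^sup>1)\<close> telescope up to an error controlled by the decrease of \<open>\<theta>\<^sub>k\<alpha>\<^sub>k\<close>.
  What remains is \<open>\<alpha>\<^sub>k\<close> times a movement or a consensus error. It is split by Young's inequality
  into a multiple of \<open>\<alpha>\<^sub>k\<^sup>2\<close>, summable because \<open>a > 1/2\<close>, and squares which are absorbed by
  the projection inequality and by the contraction of \<open>W\<close> on the complement of the consensus space.
  Hence the weighted sum of the gaps is bounded, while \<open>\<Sum>\<^sub>t \<theta>\<^sub>t\<alpha>\<^sub>t\<close> grows like \<open>k\<^sup>1\<^sup>-\<^sup>a\<^sup>-\<^sup>b\<close>.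

  The rows of \<open>Wx\<^sup>k\<close> may have own actions outside \<open>\<Omega>\<close>, where no Lipschitz bound is assumed; the
  gradients there are only known to be bounded, as monotone operators are bounded on bounded sets.
\<close>

text \<open>Monotonicity is tested against the vertices of a cube: the vertex \<open>z\<close> with the signs of
  \<open>F x\<close> gives \<open>\<Sum>\<^sub>j \<bar>F\<^sub>j x\<bar> \<le> F x \<bullet> (z - x) \<le> F z \<bullet> (z - x)\<close>, and there are finitely many \<open>z\<close>.\<close>

lemma monotone_operator_bounded:
  fixes F :: "real^'n::finite \<Rightarrow> real^'n"
  assumes mono: "monotone_operator F"
  obtains B where "B \<ge> 0" "\<And>x i. (\<And>j. \<bar>x $ j\<bar> \<le> R) \<Longrightarrow> \<bar>F x $ i\<bar> \<le> B"
proof -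
  \<comment> \<open>The side \<open>R + 1\<close> puts every vertex at distance at least 1 from
    \<open>x\<close> in each coordinate, so a factor \<open>z s $ j - x $ j\<close> of the right
    sign does not shrink \<open>\<bar>F x $ j\<bar>\<close>.\<close>
  define z :: "('n \<Rightarrow> bool) \<Rightarrow> real^'n" where "z s = (\<chi> j. if s j then R + 1 else - (R + 1))" for s
  define B where "B = (\<Sum>s\<in>UNIV. (\<Sum>j\<in>UNIV. \<bar>F (z s) $ j\<bar> * (2 * \<bar>R\<bar> + 1)))"
  have "\<bar>F x $ i\<bar> \<le> B" if x: "\<And>j. \<bar>x $ j\<bar> \<le> R" for x i
  proof -
    define s where "s j = (F x $ j \<ge> 0)" for j
    have R: "R \<ge> 0" using x[of i] by linarith
    have "\<bar>F x $ j\<bar> \<le> F x $ j * (z s $ j - x $ j)" for j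
    proof (cases "F x $ j \<ge> 0")
      case True
      then have "F x $ j * 1 \<le> F x $ j * (z s $ j - x $ j)"
        using x[of j] by (intro mult_left_mono) (auto simp: z_def s_def)
      then show ?thesis using True by simp
    next
      case False
      then have "- F x $ j * 1 \<le> - F x $ j * (x $ j - z s $ j)"
        using x[of j] by (intro mult_left_mono) (auto simp: z_def s_def)
      then show ?thesis using False by (simp add: algebra_simps)
    qed
    then have "(\<Sum>j\<in>UNIV. \<bar>F x $ j\<bar>) \<le> (\<Sum>j\<in>UNIV. F x $ j * (z s $ j - x $ j))"
      by (intro sum_mono) auto
    also have "\<dots> = F x \<bullet> (z s - x)"
      by (simp add: inner_vec_def)
    also have "\<dots> \<le> F (z s) \<bullet> (z s - x)"
      using mono unfolding monotone_operator_def by (metis inner_diff_left diff_ge_0_iff_ge)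
    also have "\<dots> \<le> (\<Sum>j\<in>UNIV. \<bar>F (z s) $ j\<bar> * (2 * \<bar>R\<bar> + 1))"
      unfolding inner_vec_def
    proof (rule sum_mono)
      fix j
      have "\<bar>z s $ j - x $ j\<bar> \<le> 2 * \<bar>R\<bar> + 1"
        using x[of j] R by (auto simp: z_def)
      then have "\<bar>F (z s) $ j\<bar> * \<bar>z s $ j - x $ j\<bar> \<le> \<bar>F (z s) $ j\<bar> * (2 * \<bar>R\<bar> + 1)"
        by (intro mult_left_mono) auto
      then show "F (z s) $ j \<bullet> (z s - x) $ j \<le> \<bar>F (z s) $ j\<bar> * (2 * \<bar>R\<bar> + 1)"
        by (simp add: abs_mult[symmetric])
    qed
    also have "\<dots> \<le> B"
      unfolding B_def by (rule member_le_sum) (auto intro!: sum_nonneg)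
    finally show ?thesis
      using member_le_sum[of i UNIV "\<lambda>j. \<bar>F x $ j\<bar>"] by simp
  qed
  moreover have "B \<ge> 0" unfolding B_def by (auto intro!: sum_nonneg)
  ultimately show ?thesis using that by blast
qed

section \<open>The mixing matrix\<close>

lemma norm_power2_vec: "(norm x)\<^sup>2 = (\<Sum>i\<in>UNIV. (x $ i)\<^sup>2)" for x :: "real^'n::finite"
  unfolding power2_norm_eq_inner unfolding inner_vec_def by (simp add: power2_eq_square)

lemma mixing_matrix_symmetric:
  assumes "mixing_matrix E W"
  shows "W $ i $ j = W $ j $ i"
proof -
  have "transpose W $ i $ j = W $ i $ j" using assms by (simp add: mixing_matrix_def)
  then show ?thesis by (simp add: transpose_def)
qed

lemma mixing_matrix_nonneg:
  assumes "mixing_matrix E W"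
  shows "0 \<le> W $ i $ j"
  using assms by (simp add: mixing_matrix_def)

lemma mixing_matrix_row_sum:
  assumes "mixing_matrix E W"
  shows "(\<Sum>j\<in>UNIV. W $ i $ j) = 1"
  using assms by (simp add: mixing_matrix_def)

lemma mixing_matrix_col_sum:
  assumes "mixing_matrix E W"
  shows "(\<Sum>i\<in>UNIV. W $ i $ j) = 1"
  using mixing_matrix_row_sum[OF assms, of j] mixing_matrix_symmetric[OF assms, of j] by simp

text \<open>Each row of \<open>W\<close> is a probability vector, so Jensen's inequality bounds the
  square of each entry by an average of squares. Summing over the rows uses that the columns sum to
  1 too.\<close>

lemma mixing_matrix_nonexpansive:
  assumes W: "mixing_matrix E W"
  shows "norm (W *v v) \<le> norm v"
proof -
  have row: "((W *v v) $ i)\<^sup>2 \<le> (\<Sum>j\<in>UNIV. W $ i $ j * (v $ j)\<^sup>2)" for i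
  proof -
    define m where "m = (W *v v) $ i"
    have m: "(\<Sum>j\<in>UNIV. W $ i $ j * v $ j) = m"
      by (simp add: m_def matrix_vector_mult_def)
    \<comment> \<open>This is the variance of \<open>v\<close> under the weights of row
      \<open>i\<close>, whose mean is \<open>m\<close>.\<close>
    have "0 \<le> (\<Sum>j\<in>UNIV. W $ i $ j * (v $ j - m)\<^sup>2)"
      using mixing_matrix_nonneg[OF W] by (intro sum_nonneg) simp
    also have "\<dots> = (\<Sum>j\<in>UNIV. W $ i $ j * (v $ j)\<^sup>2 - 2 * m * (W $ i $ j * v $ j) + m\<^sup>2 * W $ i $ j)"
      by (intro sum.cong refl) (simp add: power2_eq_square algebra_simps)
    also have "\<dots> = (\<Sum>j\<in>UNIV. W $ i $ j * (v $ j)\<^sup>2) - 2 * m * m + m\<^sup>2"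
      by (simp add: sum.distrib sum_subtractf sum_distrib_left[symmetric] m mixing_matrix_row_sum[OF W])
    finally show ?thesis by (simp add: m_def power2_eq_square)
  qed
  have "(norm (W *v v))\<^sup>2 = (\<Sum>i\<in>UNIV. ((W *v v) $ i)\<^sup>2)"
    by (rule norm_power2_vec)
  also have "\<dots> \<le> (\<Sum>i\<in>UNIV. \<Sum>j\<in>UNIV. W $ i $ j * (v $ j)\<^sup>2)"
    using row by (rule sum_mono)
  also have "\<dots> = (\<Sum>j\<in>UNIV. (\<Sum>i\<in>UNIV. W $ i $ j) * (v $ j)\<^sup>2)"
    by (subst sum.swap) (simp add: sum_distrib_right)
  also have "\<dots> = (norm v)\<^sup>2"
    by (simp add: mixing_matrix_col_sum[OF W] norm_power2_vec)
  finally show ?thesis by (rule power2_le_imp_le) simp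
qed

lemma mixing_matrix_inner:
  assumes W: "mixing_matrix E W"
  shows "(W *v u) \<bullet> v = u \<bullet> (W *v v)"
  using W by (metis dot_lmul_matrix mixing_matrix_def transpose_matrix_vector inner_commute)

text \<open>Converts multiplicity into list position: a value that occurs twice in a decreasing list
  also occurs in its tail, hence is at most the entry at position 1.\<close>

lemma second_singular_value_ge:
  fixes M :: "real^'n^'n"
  assumes "0 \<le> s" "2 \<le> dim (gram_eigenspace M (s\<^sup>2))"
  shows "s \<le> second_singular_value M"
proof -
  define xs where "xs = singular_values M"
  let ?m = "\<Sum>s\<in>singular_value_set M. replicate_mset (dim (gram_eigenspace M (s\<^sup>2))) s"
  have "\<exists>v\<in>gram_eigenspace M (s\<^sup>2). v \<noteq> 0"
  proof (rule ccontr)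
    assume "\<not> ?thesis"
    then have "gram_eigenspace M (s\<^sup>2) \<subseteq> {0}" by auto
    then have "dim (gram_eigenspace M (s\<^sup>2)) = 0" by (simp add: dim_eq_0)
    with assms show False by simp
  qed
  then have s: "s \<in> singular_value_set M"
    using assms by (auto simp: singular_value_set_def)
  have "mset xs = ?m" by (simp add: xs_def singular_values_def)
  also have "\<dots> = replicate_mset (dim (gram_eigenspace M (s\<^sup>2))) s + 
     (\<Sum>s\<in>singular_value_set M - {s}. replicate_mset (dim (gram_eigenspace M (s\<^sup>2))) s)"
    by (rule sum.remove[OF finite_singular_value_set s])
  finally have cnt: "2 \<le> count (mset xs) s" using assms by simp
  have sorted: "sorted_wrt (\<ge>) xs"
    by (simp add: xs_def singular_values_def sorted_wrt_rev)
  obtain x xs' where xs: "xs = x # xs'" using cnt by (cases xs) auto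
  have "count (mset xs) s \<le> Suc (count (mset xs') s)" by (simp add: xs)
  with cnt have "1 \<le> count (mset xs') s" by linarith
  then have mem: "s \<in> set xs'" by (metis count_eq_zero_iff not_one_le_zero set_mset_mset)
  then obtain y ys where ys: "xs' = y # ys" by (cases xs') auto
  have "s \<le> y" using mem sorted by (auto simp: xs ys)
  then show ?thesis
    by (simp add: second_singular_value_def xs_def[symmetric] xs ys)
qed

text \<open>A vector orthogonal to \<open>1\<close> whose norm is preserved would be fixed by \<open>W\<^sup>2\<close>, so the singular
  value 1 would have multiplicity at least 2.\<close>

lemma mixing_matrix_strict:
  fixes W :: "real^'n::finite^'n"
  assumes W: "mixing_matrix E W" and sv: "second_singular_value W < 1"
    and v: "(\<Sum>i\<in>UNIV. v $ i) = 0" "v \<noteq> 0"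
  shows "norm (W *v v) < norm v"
proof (rule ccontr)
  assume "\<not> ?thesis"
  then have eq: "norm (W *v v) = norm v"
    using mixing_matrix_nonexpansive[OF W, of v] by linarith
  let ?w = "W *v (W *v v)"
  \<comment> \<open>By symmetry \<open>?w \<bullet> v\<close> equals
    \<open>(norm (W *v v))\<^sup>2\<close>, and \<open>?w\<close> is no longer than
    \<open>v\<close>. So the expansion is at most 0, which forces \<open>?w = v\<close>.\<close>
  have "(norm (?w - v))\<^sup>2 = (norm ?w)\<^sup>2 - 2 * (?w \<bullet> v) + (norm v)\<^sup>2"
    by (simp add: power2_norm_eq_inner inner_diff_left inner_diff_right inner_commute)
  also have "?w \<bullet> v = (norm v)\<^sup>2"
    using eq mixing_matrix_inner[OF W, of "W *v v" v] by (metis power2_norm_eq_inner)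
  also have "(norm ?w)\<^sup>2 \<le> (norm v)\<^sup>2"
    using mixing_matrix_nonexpansive[OF W, of "W *v v"] eq by (intro power_mono) auto
  finally have wv: "?w = v" by simp
  have tr: "transpose W = W" using W by (simp add: mixing_matrix_def)
  have v1: "v \<in> gram_eigenspace W (1\<^sup>2)"
    using wv by (simp add: gram_eigenspace_def tr matrix_vector_mul_assoc)
  have "W *v 1 = 1"
    by (simp add: matrix_vector_mult_def vec_eq_iff mixing_matrix_row_sum[OF W])
  then have one1: "1 \<in> gram_eigenspace W (1\<^sup>2)"
    by (simp add: gram_eigenspace_def tr matrix_vector_mul_assoc[symmetric])
  have orth: "v \<bullet> 1 = 0" using v by (simp add: inner_vec_def)
  have ne: "v \<noteq> 1"
  proof
    assume "v = 1"
    with v(1) show False by simp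
  qed
  have "pairwise orthogonal {v, 1}"
    using orth by (auto simp: pairwise_def orthogonal_def inner_commute)
  moreover have "0 \<notin> {v, 1}" using v by simp
  ultimately have "independent {v, 1}"
    by (rule pairwise_orthogonal_independent)
  then have "card {v, 1} \<le> dim (gram_eigenspace W (1\<^sup>2))"
    using v1 one1 by (intro independent_card_le_dim) auto
  then have "2 \<le> dim (gram_eigenspace W (1\<^sup>2))" using ne by simp
  then show False using second_singular_value_ge[of 1 W] sv by simp
qed

text \<open>The strict inequality becomes uniform by compactness of the unit sphere of the zero-sum
  subspace, and homogeneity extends it to all lengths.\<close>

lemma mixing_matrix_contraction:
  fixes W :: "real^'n::finite^'n"
  assumes W: "mixing_matrix E W" and sv: "second_singular_value W < 1"
  obtains d where "0 < d" "\<And>v. (\<Sum>i\<in>UNIV. v $ i) = 0 \<Longrightarrow> (norm (W *v v))\<^sup>2 \<le> (1 - d) * (norm v)\<^sup>2"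
proof -
  define S where "S = {v :: real^'n. (\<Sum>i\<in>UNIV. v $ i) = 0} \<inter> sphere 0 1"
  have "closed {v :: real^'n. (\<Sum>i\<in>UNIV. v $ i) = 0}"
    by (intro closed_Collect_eq continuous_intros)
  then have "compact S" unfolding S_def by (intro closed_Int_compact) auto
  show ?thesis
  proof (cases "S = {}")
    \<comment> \<open>This is the case of a single player, where the zero-sum subspace is
      trivial.\<close>
    case True
    have "v = 0" if "(\<Sum>i\<in>UNIV. v $ i) = 0" for v :: "real^'n"
    proof (rule ccontr)
      assume "v \<noteq> 0"
      then have "(1 / norm v) *\<^sub>R v \<in> S"
        using that by (simp add: S_def sum_divide_distrib[symmetric])
      with True show False by simp
    qed
    then show ?thesis using that[of 1] by force
  next
    case False
    have "continuous_on S (\<lambda>v. norm (W *v v))"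
      by (intro continuous_on_norm linear_continuous_on matrix_vector_mul_bounded_linear)
    then obtain v0 where v0: "v0 \<in> S" "\<And>v. v \<in> S \<Longrightarrow> norm (W *v v) \<le> norm (W *v v0)"
      using continuous_attains_sup[OF \<open>compact S\<close> False] by blast
    have "v0 \<noteq> 0" "(\<Sum>i\<in>UNIV. v0 $ i) = 0" "norm v0 = 1" using v0 by (auto simp: S_def)
    then have q: "norm (W *v v0) < 1" using mixing_matrix_strict[OF W sv, of v0] by simp
    have "(norm (W *v v))\<^sup>2 \<le> (1 - (1 - (norm (W *v v0))\<^sup>2)) * (norm v)\<^sup>2"
      if v: "(\<Sum>i\<in>UNIV. v $ i) = 0" for v
    proof (cases "v = 0")
      case True
      then show ?thesis by simp
    next
      case False
      then have "(1 / norm v) *\<^sub>R v \<in> S"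
        using v by (simp add: S_def sum_divide_distrib[symmetric])
      then have "norm (W *v ((1 / norm v) *\<^sub>R v)) \<le> norm (W *v v0)" by (rule v0)
      then have "norm (W *v v) \<le> norm (W *v v0) * norm v"
        using False by (simp add: matrix_vector_mult_scaleR field_simps)
      then have "(norm (W *v v))\<^sup>2 \<le> (norm (W *v v0) * norm v)\<^sup>2"
        by (intro power_mono) auto
      then show ?thesis by (simp add: power_mult_distrib)
    qed
    moreover have "0 < 1 - (norm (W *v v0))\<^sup>2"
      using q by (simp add: abs_square_less_1)
    ultimately show ?thesis using that by blast
  qed
qed

section \<open>Splitting estimates into a consensus part and a disagreement part\<close>

definition consensus :: "real^'n \<Rightarrow> real^'n^'m" where
  "consensus x = (\<chi> i. x)"

text \<open>\<open>consensus (column_mean X)\<close> is the Frobenius-orthogonal projection of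
  \<open>X\<close> onto the matrices with equal rows.\<close>

definition column_mean :: "real^'n^'m::finite \<Rightarrow> real^'n" where
  "column_mean X = (\<chi> j. (\<Sum>i\<in>UNIV. X $ i $ j) / real CARD('m))"

lemma matrix_mult_consensus:
  assumes "mixing_matrix E W"
  shows "W ** consensus x = consensus x"
  by (simp add: vec_eq_iff matrix_matrix_mult_def consensus_def sum_distrib_right[symmetric]
      mixing_matrix_row_sum[OF assms])

lemma column_sum_diff_column_mean:
  fixes X :: "real^'n^'m::finite"
  shows "(\<Sum>i\<in>UNIV. (X - consensus (column_mean X)) $ i $ j) = 0"
  by (simp add: consensus_def column_mean_def sum_subtractf)

text \<open>In particular, matrices with zero column sums are orthogonal to all consensus
  matrices.\<close>

lemma inner_consensus:
  fixes X :: "real^'n::finite^'m::finite"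
  shows "X \<bullet> consensus x = (\<Sum>j\<in>UNIV. (\<Sum>i\<in>UNIV. X $ i $ j) * x $ j)"
  unfolding inner_vec_def consensus_def
  by (simp add: inner_vec_def sum_distrib_right) (rule sum.swap)

text \<open>Left multiplication by \<open>W\<close> acts on each column separately, so this
  transfers the vector bounds to matrices.\<close>

lemma norm_matrix_columns:
  fixes X :: "real^'n::finite^'m::finite"
  shows "(norm X)\<^sup>2 = (\<Sum>j\<in>UNIV. (norm (column j X))\<^sup>2)"
  unfolding power2_norm_eq_inner inner_vec_def column_def
  by (simp add: inner_vec_def) (rule sum.swap)

lemma column_matrix_mult: "column j (W ** X) = W *v column j X"
  by (simp add: vec_eq_iff column_def matrix_matrix_mult_def matrix_vector_mult_def)

lemma matrix_diff_ldistrib: "A ** (B - C) = A ** B - A ** C" for A :: "real^'n::finite^'m"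
  by (simp add: vec_eq_iff matrix_matrix_mult_def right_diff_distrib sum_subtractf)

text \<open>The disagreement \<open>U\<close> and the consensus part are orthogonal.
  \<open>W\<close> fixes the latter, contracts the former and keeps its column sums zero, so
  Pythagoras applies before and after mixing.\<close>

lemma mixing_step:
  fixes W :: "real^'n::finite^'n" and X :: "real^'n^'n"
  assumes W: "mixing_matrix E W"
    and d: "\<And>v. (\<Sum>i\<in>UNIV. v $ i) = 0 \<Longrightarrow> (norm (W *v v))\<^sup>2 \<le> (1 - d) * (norm v)\<^sup>2"
  shows "(norm (W ** X - consensus x))\<^sup>2
    \<le> (norm (X - consensus x))\<^sup>2 - d * (norm (X - consensus (column_mean X)))\<^sup>2"
proof -
  define U where "U = X - consensus (column_mean X)"
  define e where "e = column_mean X - x"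
  have X: "X - consensus x = U + consensus e"
    by (simp add: U_def e_def consensus_def vec_eq_iff)
  have WU: "W ** U = W ** X - consensus (column_mean X)"
    unfolding U_def 
    by (simp add: matrix_diff_ldistrib matrix_mult_consensus[OF W])
  have WX: "W ** X - consensus x = W ** U + consensus e"
    by (simp add: WU e_def consensus_def vec_eq_iff)
  have colU: "(\<Sum>i\<in>UNIV. U $ i $ j) = 0" for j
    unfolding U_def by (rule column_sum_diff_column_mean)
  have colWU: "(\<Sum>i\<in>UNIV. (W ** U) $ i $ j) = 0" for j
    unfolding matrix_matrix_mult_def
    by (simp, subst sum.swap)
       (simp add: sum_distrib_right[symmetric] mixing_matrix_col_sum[OF W] colU)
  have pyth: "(norm (V + consensus e))\<^sup>2 = (norm V)\<^sup>2 + (norm (consensus e :: real^'n^'n))\<^sup>2"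
    if "\<And>j. (\<Sum>i\<in>UNIV. V $ i $ j) = 0" for V :: "real^'n^'n"
    by (subst norm_add_Pythagorean) (simp_all add: orthogonal_def inner_consensus that)
  have "(norm (W ** U))\<^sup>2 \<le> (1 - d) * (norm U)\<^sup>2"
    unfolding norm_matrix_columns sum_distrib_left column_matrix_mult
    by (intro sum_mono d) (simp add: column_def colU)
  then have "(norm (W ** U + consensus e))\<^sup>2 \<le> (norm (U + consensus e))\<^sup>2 - d * (norm U)\<^sup>2"
    unfolding pyth[OF colU] pyth[OF colWU] by (simp add: algebra_simps)
  then show ?thesis by (simp add: WX X U_def[symmetric])
qed

lemma norm_mixing_le:
  fixes W :: "real^'n::finite^'n" and X :: "real^'n^'n"
  assumes W: "mixing_matrix E W"
  shows "norm (W ** X) \<le> norm X"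
proof (rule power2_le_imp_le)
  show "(norm (W ** X))\<^sup>2 \<le> (norm X)\<^sup>2"
    unfolding norm_matrix_columns column_matrix_mult
    by (intro sum_mono power_mono mixing_matrix_nonexpansive[OF W]) auto
qed simp

lemma norm_matrix_le_entries:
  fixes X :: "real^'n::finite^'m::finite"
  assumes "\<And>i j. \<bar>X $ i $ j\<bar> \<le> B"
  shows "norm X \<le> real CARD('m) * (real CARD('n) * B)"
proof -
  have row: "norm (X $ i) \<le> real CARD('n) * B" for i
    using norm_le_l1_cart[of "X $ i"] sum_bounded_above[of UNIV "\<lambda>j. \<bar>X $ i $ j\<bar>" B] assms
    by fastforce
  have "norm X \<le> (\<Sum>i\<in>UNIV. norm (X $ i))"
    unfolding norm_vec_def by (rule L2_set_le_sum) simp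
  also have "\<dots> \<le> real CARD('m) * (real CARD('n) * B)"
    using sum_bounded_above[of UNIV "\<lambda>i. norm (X $ i)"] row by fastforce
  finally show ?thesis .
qed

section \<open>Projection, gradients and boundedness of the iterates\<close>

lemma joint_actions_Inter: "joint_actions \<Omega> = (\<Inter>i. (\<lambda>x. x $ i) -` \<Omega> i)"
  by (auto simp: joint_actions_def)

lemma estimation_set_iff: "X \<in> estimation_set \<Omega> \<longleftrightarrow> (\<forall>i. X $ i $ i \<in> \<Omega> i)"
  by (simp add: estimation_set_def joint_actions_def diag_vec_def)

lemma closed_joint_actions:
  assumes "\<And>i. closed (\<Omega> i)"
  shows "closed (joint_actions \<Omega>)"
  unfolding joint_actions_Inter
  by (intro closed_INT ballI closed_vimage assms continuous_intros)

lemma convex_joint_actions: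
  assumes "\<And>i. convex (\<Omega> i)"
  shows "convex (joint_actions \<Omega>)"
  using assms unfolding convex_def joint_actions_def by simp

lemma closed_estimation_set:
  fixes \<Omega> :: "'n::finite \<Rightarrow> real set"
  assumes "\<And>i. closed (\<Omega> i)"
  shows "closed (estimation_set \<Omega>)"
proof -
  have "estimation_set \<Omega> = (\<Inter>i. (\<lambda>X. X $ i $ i) -` \<Omega> i)"
    by (auto simp: estimation_set_iff)
  then show ?thesis
    by (simp, intro closed_INT ballI closed_vimage assms continuous_intros)
qed

lemma convex_estimation_set:
  fixes \<Omega> :: "'n::finite \<Rightarrow> real set"
  assumes "\<And>i. convex (\<Omega> i)"
  shows "convex (estimation_set \<Omega>)"
  using assms unfolding convex_def by (simp add: estimation_set_iff)

text \<open>The set constrains diagonal entries only. Replacing the off-diagonal entries of the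
  projection \<open>P\<close> by those of \<open>Y\<close> gives an admissible \<open>z\<close>, and
  the variational inequality at \<open>z\<close> reads
  \<open>(norm (z - P))\<^sup>2 \<le> 0\<close>.\<close>

lemma closest_point_estimation_set_offdiag:
  fixes \<Omega> :: "'n::finite \<Rightarrow> real set"
  assumes conv: "\<And>i. convex (\<Omega> i)" and cl: "\<And>i. closed (\<Omega> i)"
    and ne: "estimation_set \<Omega> \<noteq> {}" and ij: "i \<noteq> j"
  shows "closest_point (estimation_set \<Omega>) Y $ i $ j = Y $ i $ j"
proof -
  let ?S = "estimation_set \<Omega>"
  define P where "P = closest_point ?S Y"
  define z where "z = (\<chi> i j. if i = j then P $ i $ j else Y $ i $ j)"
  have P: "P \<in> ?S"
    unfolding P_def by (rule closest_point_in_set[OF closed_estimation_set[OF cl] ne])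
  then have z: "z \<in> ?S" by (simp add: estimation_set_iff z_def)
  have "(Y - P) \<bullet> (z - P) \<le> 0"
    unfolding P_def
    by (rule closest_point_dot[OF convex_estimation_set[OF conv] closed_estimation_set[OF cl] z])
  also have "(Y - P) \<bullet> (z - P) = (z - P) \<bullet> (z - P)"
    unfolding inner_vec_def by (intro sum.cong refl) (simp add: z_def)
  finally have "z - P = 0" by (metis inner_gt_zero_iff not_less)
  then have "z $ i $ j = P $ i $ j" by simp
  then show ?thesis using ij by (simp add: z_def P_def)
qed

text \<open>The law of cosines for \<open>H\<close>, \<open>P\<close>, \<open>z\<close> combined
  with the variational inequality of the projection \<open>P\<close> of
  \<open>H - \<alpha> *\<^sub>R G\<close>.\<close>

lemma projected_step:
  fixes H G z P :: "'a::real_inner"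
  assumes "(H - \<alpha> *\<^sub>R G - P) \<bullet> (z - P) \<le> 0"
  shows "(norm (P - z))\<^sup>2 + (norm (P - H))\<^sup>2 + 2 * \<alpha> * (G \<bullet> (P - z)) \<le> (norm (H - z))\<^sup>2"
  using assms by (simp add: power2_norm_eq_inner algebra_simps inner_commute)

section \<open>Lipschitz bounds for the partial derivatives\<close>

lemma set_action_self: "set_action i (x $ i) x = x"
  by (simp add: set_action_def vec_eq_iff)

lemma others_lipschitz_norm:
  fixes x y :: "real^'n::finite"
  assumes lip: "others_lipschitz J \<Omega> i l" and l: "0 \<le> l" and x: "x $ i \<in> \<Omega> i"
  shows "\<bar>partial_cost J i x - partial_cost J i (set_action i (x $ i) y)\<bar> \<le> l * norm (x - y)"
proof -
  have "L2_set (\<lambda>j. x $ j - y $ j) (- {i}) \<le> norm (x - y)"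
    unfolding norm_vec_def L2_set_def by (intro real_sqrt_le_mono) (auto intro!: sum_mono2)
  moreover have "\<bar>partial_cost J i x - partial_cost J i (set_action i (x $ i) y)\<bar>
      \<le> l * L2_set (\<lambda>j. x $ j - y $ j) (- {i})"
    using lip x unfolding others_lipschitz_def by (metis set_action_self)
  ultimately show ?thesis using l by (meson mult_left_mono order_trans)
qed

text \<open>The mixed point, with the own action of \<open>x\<close> and the other actions of
  \<open>y\<close>, splits an increment into the two Lipschitz bounds. Continuity serves to attain
  the maximum over the joint actions.\<close>

lemma continuous_on_pseudo_gradient:
  fixes J :: "'n::finite \<Rightarrow> real^'n \<Rightarrow> real"
  assumes nonneg: "\<And>i. 0 \<le> Lown i" "\<And>i. 0 \<le> Lothers i"
    and own: "\<And>i. own_lipschitz J \<Omega> i (Lown i)"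
    and others: "\<And>i. others_lipschitz J \<Omega> i (Lothers i)"
  shows "continuous_on (joint_actions \<Omega>) (pseudo_gradient J)"
  unfolding pseudo_gradient_def
proof (intro continuous_on_vec_lambda)
  fix i
  have "(Lothers i + Lown i)-lipschitz_on (joint_actions \<Omega>) (partial_cost J i)"
  proof (rule lipschitz_onI)
    fix x y assume xy: "x \<in> joint_actions \<Omega>" "y \<in> joint_actions \<Omega>"
    have "\<bar>partial_cost J i x - partial_cost J i (set_action i (x $ i) y)\<bar> \<le> Lothers i * norm (x - y)"
      using xy by (intro others_lipschitz_norm[OF others nonneg(2)]) (simp add: joint_actions_def)
    moreover have "\<bar>partial_cost J i (set_action i (x $ i) y) - partial_cost J i (set_action i (y $ i) y)\<bar>
        \<le> Lown i * \<bar>x $ i - y $ i\<bar>"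
      using own[of i] xy unfolding own_lipschitz_def joint_actions_def by blast
    moreover have "Lown i * \<bar>x $ i - y $ i\<bar> \<le> Lown i * norm (x - y)"
      using component_le_norm_cart[of "x - y" i] nonneg(1) by (intro mult_left_mono) auto
    ultimately show "dist (partial_cost J i x) (partial_cost J i y) \<le> (Lothers i + Lown i) * dist x y"
      by (simp add: set_action_self dist_norm distrib_right)
  qed (simp add: nonneg)
  then show "continuous_on (joint_actions \<Omega>) (partial_cost J i)"
    by (rule lipschitz_on_continuous_on)
qed

lemma norm_diag_vec_le:
  fixes M :: "real^'n::finite^'n"
  shows "norm (diag_vec M) \<le> norm M"
  unfolding norm_vec_def[of M] norm_vec_def[of "diag_vec M"]
  by (intro L2_set_mono) (simp_all add: diag_vec_def component_le_norm_cart)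

text \<open>Monotonicity moves the gradient from \<open>x\<close> to the joint action. The joint
  action and row \<open>i\<close> of \<open>X\<close> share the own action of player
  \<open>i\<close>, which lies in \<open>\<Omega> i\<close>, so only the bound in the opponents'
  actions enters; both are within \<open>norm (X - consensus m)\<close> of \<open>m\<close>, for any
  \<open>m\<close>.\<close>

lemma gap_le_estimated_gap:
  fixes J :: "'n::finite \<Rightarrow> real^'n \<Rightarrow> real"
  assumes mono: "monotone_operator (pseudo_gradient J)"
    and l: "\<And>i. 0 \<le> l i" and lip: "\<And>i. others_lipschitz J \<Omega> i (l i)"
    and X: "X \<in> estimation_set \<Omega>"
    and D: "\<And>i. \<bar>X $ i $ i - x $ i\<bar> \<le> D"
  shows "pseudo_gradient J x \<bullet> (diag_vec X - x)
    \<le> gradient_matrix J X \<bullet> (X - consensus x) + (\<Sum>i\<in>UNIV. 2 * l i * D) * norm (X - consensus m)"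
proof -
  let ?y = "diag_vec X" and ?N = "norm (X - consensus m)"
  have "?y - m = diag_vec (X - consensus m)"
    by (simp add: diag_vec_def consensus_def vec_eq_iff)
  then have ym: "norm (?y - m) \<le> ?N"
    by (metis norm_diag_vec_le)
  have main: "pseudo_gradient J ?y $ i * (?y - x) $ i
      \<le> partial_cost J i (X $ i) * (X $ i $ i - x $ i) + 2 * l i * D * ?N" for i
  proof -
    have "X $ i - m = (X - consensus m) $ i" by (simp add: consensus_def)
    then have "norm (X $ i - m) \<le> ?N"
      by (metis Finite_Cartesian_Product.norm_nth_le)
    then have "norm (?y - X $ i) \<le> 2 * ?N"
      using ym norm_triangle_ineq4[of "?y - m" "X $ i - m"] by simp
    then have "l i * norm (?y - X $ i) \<le> l i * (2 * ?N)"
      using l by (intro mult_left_mono) auto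
    moreover have "set_action i (?y $ i) (X $ i) = X $ i"
      by (simp add: set_action_def diag_vec_def vec_eq_iff)
    then have "\<bar>partial_cost J i ?y - partial_cost J i (X $ i)\<bar> \<le> l i * norm (?y - X $ i)"
      using others_lipschitz_norm[OF lip l, of ?y i "X $ i"] X
      by (simp add: estimation_set_iff diag_vec_def)
    ultimately have "\<bar>partial_cost J i ?y - partial_cost J i (X $ i)\<bar> \<le> l i * (2 * ?N)"
      by linarith
    then have "\<bar>partial_cost J i ?y - partial_cost J i (X $ i)\<bar> * \<bar>X $ i $ i - x $ i\<bar>
        \<le> (l i * (2 * ?N)) * D"
      using D l by (intro mult_mono) auto
    then have "(partial_cost J i ?y - partial_cost J i (X $ i)) * (X $ i $ i - x $ i) \<le> (l i * (2 * ?N)) * D"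
      by (simp add: abs_mult[symmetric])
    then show ?thesis
      by (simp add: pseudo_gradient_def diag_vec_def algebra_simps)
  qed
  have "pseudo_gradient J x \<bullet> (?y - x) \<le> pseudo_gradient J ?y \<bullet> (?y - x)"
    using mono unfolding monotone_operator_def by (metis inner_diff_left diff_ge_0_iff_ge)
  also have "\<dots> \<le> (\<Sum>i\<in>UNIV. partial_cost J i (X $ i) * (X $ i $ i - x $ i) + 2 * l i * D * ?N)"
    unfolding inner_vec_def inner_real_def using main by (intro sum_mono) auto
  also have "\<dots> = (\<Sum>i\<in>UNIV. partial_cost J i (X $ i) * (X $ i $ i - x $ i)) + (\<Sum>i\<in>UNIV. 2 * l i * D) * ?N"
    by (simp add: sum.distrib sum_distrib_right)
  also have "(\<Sum>i\<in>UNIV. partial_cost J i (X $ i) * (X $ i $ i - x $ i)) = gradient_matrix J X \<bullet> (X - consensus x)"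
    unfolding inner_vec_def
    by (simp add: inner_vec_def gradient_matrix_def consensus_def if_distrib[of "\<lambda>t. t * _"] cong: if_cong)
  finally show ?thesis .
qed

section \<open>Uniform bounds along a run\<close>

lemma norm_gradient_matrix_le:
  fixes J :: "'n::finite \<Rightarrow> real^'n \<Rightarrow> real"
  assumes B: "B \<ge> 0" "\<And>x i. (\<And>j. \<bar>x $ j\<bar> \<le> R) \<Longrightarrow> \<bar>pseudo_gradient J x $ i\<bar> \<le> B"
    and X: "\<And>i j. \<bar>X $ i $ j\<bar> \<le> R"
  shows "norm (gradient_matrix J X) \<le> real CARD('n) * (real CARD('n) * B)"
  using B(1) B(2)[OF X] 
  by (intro norm_matrix_le_entries) (simp add: gradient_matrix_def pseudo_gradient_def)

lemma mixing_entries_le: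
  fixes W :: "real^'n::finite^'n" and X :: "real^'n^'n"
  assumes W: "mixing_matrix E W" and X: "\<And>i j. \<bar>X $ i $ j\<bar> \<le> R"
  shows "\<bar>(W ** X) $ i $ j\<bar> \<le> R"
proof -
  have "\<bar>(W ** X) $ i $ j\<bar> \<le> (\<Sum>k\<in>UNIV. \<bar>W $ i $ k * X $ k $ j\<bar>)"
    by (simp add: matrix_matrix_mult_def sum_abs)
  also have "\<dots> \<le> (\<Sum>k\<in>UNIV. W $ i $ k * R)"
    using X mixing_matrix_nonneg[OF W] by (intro sum_mono) (simp add: abs_mult mult_left_mono)
  also have "\<dots> = R"
    by (simp add: sum_distrib_right[symmetric] mixing_matrix_row_sum[OF W])
  finally show ?thesis .
qed

text \<open>\<open>gradient_matrix\<close> is diagonal and the projection leaves off-diagonal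
  entries alone, so these evolve by averaging with the weights of \<open>W\<close>, which cannot
  increase the maximal modulus. Projected diagonals lie in the bounded sets
  \<open>\<Omega> i\<close>.\<close>

lemma algorithm_run_bounded:
  fixes J :: "'n::finite \<Rightarrow> real^'n \<Rightarrow> real"
  assumes conv: "\<And>i. convex (\<Omega> i)" and cl: "\<And>i. closed (\<Omega> i)" and bdd: "\<And>i. bounded (\<Omega> i)"
    and W: "mixing_matrix E W" and run: "algorithm_run J \<Omega> W \<alpha> \<mu> X Xhat"
  obtains R where "\<And>k i j. \<bar>X k $ i $ j\<bar> \<le> R" "\<And>k i j. \<bar>Xhat k $ i $ j\<bar> \<le> R"
    "\<And>i t. t \<in> \<Omega> i \<Longrightarrow> \<bar>t\<bar> \<le> R"
proof -
  let ?S = "estimation_set \<Omega>"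
  have X0: "X 0 \<in> ?S" and hat: "Xhat k = W ** X k" and X1: "X 1 = Xhat 0"
    and step: "k \<ge> 1 \<Longrightarrow> X (k + 1) = closest_point ?S
        (Xhat k - \<alpha> k *\<^sub>R (gradient_matrix J (Xhat k)
           + \<mu> k *\<^sub>R (gradient_matrix J (X k) - gradient_matrix J (Xhat (k - 1)))))" for k
    using run by (auto simp: algorithm_run_def)
  have ne: "?S \<noteq> {}" using X0 by auto
  have "bounded (\<Union>i. \<Omega> i)" using bdd by auto
  then obtain R1 where R1: "\<And>i t. t \<in> \<Omega> i \<Longrightarrow> \<bar>t\<bar> \<le> R1"
    unfolding bounded_iff by auto
  define R where "R = max R1 (norm (X 0))"
  have \<Omega>R: "\<bar>t\<bar> \<le> R" if "t \<in> \<Omega> i" for i t using R1[OF that] by (simp add: R_def)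
  have X0R: "\<bar>X 0 $ i $ j\<bar> \<le> R" for i j
    using component_le_norm_cart[of "X 0 $ i" j] Finite_Cartesian_Product.norm_nth_le[of "X 0" i] by (simp add: R_def)
  have XR: "\<bar>X k $ i $ j\<bar> \<le> R" for k i j
  proof (induction k arbitrary: i j)
    case 0
    show ?case by (rule X0R)
  next
    case (Suc k)
    have hatR: "\<bar>Xhat k $ i $ j\<bar> \<le> R" for i j
      unfolding hat by (rule mixing_entries_le[OF W Suc])
    show ?case
    proof (cases "k = 0")
      \<comment> \<open>The first update is mixing without projection, so the diagonal of
        \<open>X 1\<close> is bounded by averaging, not by membership in
        \<open>\<Omega> i\<close>.\<close>
      case True
      then show ?thesis using X1 hatR by simp
    next
      case False
      then have k: "X (Suc k) = closest_point ?S
        (Xhat k - \<alpha> k *\<^sub>R (gradient_matrix J (Xhat k)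
           + \<mu> k *\<^sub>R (gradient_matrix J (X k) - gradient_matrix J (Xhat (k - 1)))))"
        using step[of k] by simp
      show ?thesis
      proof (cases "i = j")
        case True
        have "X (Suc k) \<in> ?S"
          unfolding k by (rule closest_point_in_set[OF closed_estimation_set[OF cl] ne])
        then show ?thesis using \<Omega>R True by (auto simp: estimation_set_iff)
      next
        case False
        then have "X (Suc k) $ i $ j = Xhat k $ i $ j"
          unfolding k closest_point_estimation_set_offdiag[OF conv cl ne False]
          by (simp add: gradient_matrix_def)
        then show ?thesis using hatR by simp
      qed
    qed
  qed
  have "\<bar>Xhat k $ i $ j\<bar> \<le> R" for k i j
    unfolding hat by (rule mixing_entries_le[OF W XR])
  with XR \<Omega>R show ?thesis using that by blast
qed

section \<open>Convergence rate\<close>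

text \<open>One iteration in scalars: \<open>D\<close> and \<open>D'\<close> are squared distances
  to a consensus matrix before and after, \<open>r\<close> is the distance of the new iterate from
  the mixed one, \<open>u\<close> the disagreement of the old one, \<open>e\<close> and
  \<open>e'\<close> are correction terms, \<open>p\<close> is the gap. The squares absorb all terms
  linear in \<open>r\<close> and \<open>u\<close> at a price of order
  \<open>\<alpha>\<^sup>2\<close>.\<close>

lemma step_estimate:
  fixes \<alpha> \<theta> :: real
  assumes proj: "D' + r\<^sup>2 + 2 * \<alpha> * G \<le> D - d * u\<^sup>2"
    and G: "G = T - e' + \<mu> * e + \<mu> * z"
    and z: "\<bar>z\<bar> \<le> B * (r + 2 * u)"
    and p: "p \<le> T + Q * (r + u)"
    and nonneg: "0 \<le> \<mu>" "\<mu> \<le> 1" "0 \<le> \<alpha>" "0 \<le> \<theta>" "0 \<le> B" "0 \<le> Q" "0 \<le> r" "0 \<le> u" "0 < d"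
  shows "\<theta> * \<alpha> * p \<le> \<theta> / 2 * (D - D') + \<theta> * \<alpha> * e' - \<theta> * \<alpha> * \<mu> * e
    + \<theta> * (\<alpha>\<^sup>2 * ((2 * B + Q)\<^sup>2 * (1 + 1 / d) / 2))"
proof -
  define q where "q = \<alpha> * (2 * B + Q)"
  have "\<mu> * \<bar>z\<bar> \<le> 1 * (B * (r + 2 * u))" using z nonneg by (intro mult_mono) auto
  then have z': "- (\<mu> * z) \<le> B * (r + 2 * u)"
    using mult_left_mono[OF abs_ge_minus_self[of z], of \<mu>] nonneg by simp
  have "B * (r + 2 * u) + Q * (r + u) \<le> (2 * B + Q) * (r + u)"
    using nonneg by (simp add: algebra_simps)
  then have "p \<le> G + e' - \<mu> * e + (2 * B + Q) * (r + u)"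
    using p z' G by linarith
  then have "\<alpha> * p \<le> \<alpha> * (G + e' - \<mu> * e + (2 * B + Q) * (r + u))"
    using nonneg by (intro mult_left_mono) auto
  then have 1: "\<alpha> * p \<le> \<alpha> * G + \<alpha> * e' - \<alpha> * \<mu> * e + q * r + q * u"
    by (simp add: q_def algebra_simps)
  \<comment> \<open>Young's inequality with weights 1 for \<open>r\<close> and \<open>d\<close> for
    \<open>u\<close>, so that the squares cancel exactly against half of those in
    \<open>proj\<close>.\<close>
  have 2: "q * r \<le> r\<^sup>2 / 2 + q\<^sup>2 / 2"
    using sum_squares_ge_zero[of "q - r" 0] by (simp add: power2_eq_square algebra_simps)
  have "0 \<le> (d * u - q)\<^sup>2 / d" using nonneg by simp
  then have 3: "q * u \<le> d * u\<^sup>2 / 2 + q\<^sup>2 / (2 * d)"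
    using nonneg by (simp add: power2_eq_square field_simps)
  have 4: "\<alpha> * G \<le> (D - D') / 2 - d * u\<^sup>2 / 2 - r\<^sup>2 / 2"
    using proj by (simp add: field_simps)
  have "\<alpha> * p \<le> (D - D') / 2 + \<alpha> * e' - \<alpha> * \<mu> * e + (q\<^sup>2 / 2 + q\<^sup>2 / (2 * d))"
    using 1 2 3 4 by linarith
  also have "q\<^sup>2 / 2 + q\<^sup>2 / (2 * d) = q\<^sup>2 * (1 + 1 / d) / 2"
    using nonneg by (simp add: field_simps)
  also have "\<dots> = \<alpha>\<^sup>2 * ((2 * B + Q)\<^sup>2 * (1 + 1 / d) / 2)"
    by (simp add: q_def power_mult_distrib)
  finally have "\<theta> * (\<alpha> * p) \<le> \<theta> * ((D - D') / 2 + \<alpha> * e' - \<alpha> * \<mu> * e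
      + \<alpha>\<^sup>2 * ((2 * B + Q)\<^sup>2 * (1 + 1 / d) / 2))"
    using nonneg by (intro mult_left_mono) auto
  then show ?thesis by (simp add: algebra_simps diff_divide_distrib)
qed

text \<open>Summation by parts, written as the decrease of a potential; the resulting bound involves
  only initial values and the terms \<open>s k\<close>.\<close>

lemma telescoped_sum_bound:
  fixes D e c \<theta> \<mu> g s :: "nat \<Rightarrow> real"
  assumes step: "\<And>k. k \<ge> 1 \<Longrightarrow>
      g k \<le> \<theta> k / 2 * (D k - D (Suc k)) + c k * e (Suc k) - c k * \<mu> k * e k + s k"
    and c: "\<And>k. 0 < c k" "\<And>k. c (Suc k) \<le> c k"
    and \<mu>: "\<And>k. k \<ge> 1 \<Longrightarrow> \<mu> k = c k / c (k - 1)"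
    and \<theta>: "\<And>k. 0 \<le> \<theta> k" "\<And>k. \<theta> (Suc k) \<le> \<theta> k"
    and D: "\<And>k. 0 \<le> D k" and e: "\<And>k. \<bar>e k\<bar> \<le> M"
  shows "(\<Sum>k=1..K. g k) \<le> \<theta> 1 / 2 * D 1 + 3 * M * c 0 + (\<Sum>k=1..K. s k)"
proof -
  \<comment> \<open>The term \<open>2 * M * c (k - 1)\<close> pays for \<open>c k * \<mu> k \<noteq> c (k - 1)\<close>: the weights of consecutive
    correction terms do not match exactly.\<close>
  define \<Phi> where "\<Phi> k = \<theta> k / 2 * D k - c (k - 1) * e k + 2 * M * c (k - 1)" for k
  have M: "M \<ge> 0" using e[of 0] by linarith
  have g: "g k \<le> \<Phi> k - \<Phi> (Suc k) + s k" if k: "k \<ge> 1" for k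
  proof -
    have ck: "c k \<le> c (k - 1)" using c(2)[of "k - 1"] k by simp
    have c0: "0 < c (k - 1)" by (rule c)
    have \<mu>1: "\<mu> k \<le> 1" "0 \<le> \<mu> k" using ck c0 c(1)[of k] by (simp_all add: \<mu>[OF k] less_imp_le)
    \<comment> \<open>The mismatch is \<open>c (k - 1) - c k\<close> plus
      \<open>c k * (1 - \<mu> k)\<close>. The second part is at most
      \<open>c (k - 1) * (1 - \<mu> k) = c (k - 1) - c k\<close>, whence the factor 2.\<close>
    have ck2: "c k * (1 - \<mu> k) \<le> c (k - 1) * (1 - \<mu> k)"
      using ck \<mu>1 by (intro mult_right_mono) auto
    have "c (k - 1) * (1 - \<mu> k) = c (k - 1) - c k"
      using c0 by (simp add: \<mu>[OF k] field_simps)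
    with ck2 have w: "c (k - 1) - c k * \<mu> k \<le> 2 * (c (k - 1) - c k)"
      by (simp add: algebra_simps)
    have w0: "0 \<le> c (k - 1) - c k * \<mu> k"
      using ck c(1)[of k] mult_left_le[OF \<mu>1(1), of "c k"] by linarith
    have "(c (k - 1) - c k * \<mu> k) * e k \<le> 2 * (c (k - 1) - c k) * M"
      using w w0 e[of k] M by (intro order_trans[OF mult_left_mono mult_right_mono]) auto
    moreover have "\<theta> (Suc k) * D (Suc k) \<le> \<theta> k * D (Suc k)"
      using \<theta> D by (intro mult_right_mono) auto
    ultimately show ?thesis
      using step[OF k] by (simp add: \<Phi>_def algebra_simps diff_divide_distrib)
  qed
  have "(\<Sum>k=1..K. g k) \<le> \<Phi> 1 - \<Phi> (Suc K) + (\<Sum>k=1..K. s k)"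
  proof (induction K)
    case (Suc K)
    then show ?case using g[of "Suc K"] by simp
  qed simp
  \<comment> \<open>The reserve \<open>2 * M * c K\<close> outweighs the correction term, whose
    modulus is at most \<open>M * c K\<close>.\<close>
  moreover have "\<Phi> (Suc K) \<ge> 0"
  proof -
    have "c K * e (Suc K) \<le> c K * M" "0 \<le> M * c K"
      using e[of "Suc K"] c(1)[of K] M by (auto intro!: mult_left_mono)
    moreover have "0 \<le> \<theta> (Suc K) / 2 * D (Suc K)" using \<theta> D by simp
    ultimately show ?thesis by (simp add: \<Phi>_def algebra_simps)
  qed
  moreover have "\<Phi> 1 \<le> \<theta> 1 / 2 * D 1 + 3 * M * c 0"
  proof -
    have "- (c 0 * e 1) \<le> c 0 * M"
      using mult_left_mono[of "- e 1" M "c 0"] e[of 1] c(1)[of 0] by simp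
    then show ?thesis by (simp add: \<Phi>_def algebra_simps)
  qed
  ultimately show ?thesis by linarith
qed

theorem theorem1:
  fixes J :: "'n::finite \<Rightarrow> real^'n \<Rightarrow> real"
    and \<Omega> :: "'n \<Rightarrow> real set"
    and Lown Lothers :: "'n \<Rightarrow> real"
    and L A a b :: real
    and E :: "'n set set"
    and W :: "real^'n^'n"
    and \<alpha> \<mu> \<theta> :: "nat \<Rightarrow> real"
    and X Xhat :: "nat \<Rightarrow> real^'n^'n"
  assumes action_sets: "\<And>i. convex (\<Omega> i)" "\<And>i. closed (\<Omega> i)"
    and cost_convex: "\<And>i x. convex_on UNIV (\<lambda>t. J i (set_action i t x))"
    and cost_C1: "\<And>i x. (\<lambda>t. J i (set_action i t x)) C1_differentiable_on UNIV"
    and action_sets_bounded: "\<And>i. bounded (\<Omega> i)"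
    and lipschitz_nonneg: "\<And>i. 0 \<le> Lown i" "\<And>i. 0 \<le> Lothers i"
    and lipschitz_own: "\<And>i. own_lipschitz J \<Omega> i (Lown i)"
    and lipschitz_others: "\<And>i. others_lipschitz J \<Omega> i (Lothers i)"
    and L: "L = (MAX i. sqrt ((Lown i)\<^sup>2 + (Lothers i)\<^sup>2))"
    and graph: "undirected_graph E" "graph_connected E"
    and mixing: "mixing_matrix E W"
    and sigma: "0 < second_singular_value W" "second_singular_value W < 1"
    and F_monotone: "monotone_operator (pseudo_gradient J)"
    and exponents: "a > 0" "b > 0" "a > 1/2" "a + b < 1"
    and A_pos: "0 < A"
    and A_bound: "L > 0 \<Longrightarrow> A < 1 / (2 * L) * (1 / 2 powr (a + b / 2))"
    and \<alpha>: "\<And>k. \<alpha> k = A / (real k + 1) powr a"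
    and \<mu>: "\<And>k. \<mu> k = (real k / (real k + 1)) powr (a + b)"
    and \<theta>: "\<And>t. \<theta> t = 1 / (real t + 1) powr b"
    and run: "algorithm_run J \<Omega> W \<alpha> \<mu> X Xhat"
  shows "\<exists>gap :: nat \<Rightarrow> real.
    (\<forall>k\<ge>1.
       (\<exists>x\<in>joint_actions \<Omega>. gap k = pseudo_gradient J x \<bullet> (weighted_average \<theta> \<alpha> X k - x)) \<and>
       (\<forall>x\<in>joint_actions \<Omega>. pseudo_gradient J x \<bullet> (weighted_average \<theta> \<alpha> X k - x) \<le> gap k)) \<and>
    gap \<in> O(\<lambda>k. 1 / (real k + 1) powr (1 - a - b))"
proof -
  obtain R where R: "\<And>k i j. \<bar>X k $ i $ j\<bar> \<le> R" "\<And>k i j. \<bar>Xhat k $ i $ j\<bar> \<le> R"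
    "\<And>i t. t \<in> \<Omega> i \<Longrightarrow> \<bar>t\<bar> \<le> R"
    using algorithm_run_bounded[OF action_sets action_sets_bounded mixing run] by blast
  obtain B0 where B0: "B0 \<ge> 0"
    "\<And>x i. (\<And>j. \<bar>x $ j\<bar> \<le> R) \<Longrightarrow> \<bar>pseudo_gradient J x $ i\<bar> \<le> B0"
    using monotone_operator_bounded[OF F_monotone, of R] by blast
  obtain d where d: "0 < d"
    "\<And>v. (\<Sum>i\<in>UNIV. v $ i) = 0 \<Longrightarrow> (norm (W *v v))\<^sup>2 \<le> (1 - d) * (norm v)\<^sup>2"
    using mixing_matrix_contraction[OF mixing sigma(2)] by blast
  let ?S = "estimation_set \<Omega>"
  have X0: "X 0 \<in> ?S" and hat: "\<And>k. Xhat k = W ** X k"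
    and step: "\<And>k. k \<ge> 1 \<Longrightarrow> X (Suc k) = closest_point ?S
        (Xhat k - \<alpha> k *\<^sub>R (gradient_matrix J (Xhat k)
           + \<mu> k *\<^sub>R (gradient_matrix J (X k) - gradient_matrix J (Xhat (k - 1)))))"
    using run by (auto simp: algorithm_run_def)
  have ne: "?S \<noteq> {}" using X0 by auto
  \<comment> \<open>Projected iterates start with \<open>X 2\<close>.\<close>
  have XS: "X (Suc k) \<in> ?S" if "k \<ge> 1" for k
    unfolding step[OF that]
    by (rule closest_point_in_set[OF closed_estimation_set[OF action_sets(2)] ne])

  \<comment> \<open>Constants and properties of the step sizes\<close>
  let ?n = "real CARD('n)"
  define N where "N = ?n * (?n * R)"
  define G where "G = ?n * (?n * B0)"
  \<comment> \<open>\<open>Q\<close> is the factor of \<open>gap_le_estimated_gap\<close> for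
    \<open>D = 2 * R\<close>, \<open>T\<close> that of \<open>step_estimate\<close> for
    \<open>B = 2 * G\<close>; \<open>C\<close> collects the initial terms of
    \<open>telescoped_sum_bound\<close> and the whole series.\<close>
  define Q where "Q = (\<Sum>i\<in>UNIV. 2 * Lothers i * (2 * R))"
  define T where "T = (2 * (2 * G) + Q)\<^sup>2 * (1 + 1 / d) / 2"
  define C where "C = (2 * N)\<^sup>2 + 3 * (2 * G * (2 * N)) * A
    + (\<Sum>k. A\<^sup>2 * (real (Suc k) powr (- (2 * a)) * T))"
  have R0: "R \<ge> 0" using R(1)[of 0 undefined undefined] by linarith
  have Q0: "Q \<ge> 0" unfolding Q_def using lipschitz_nonneg R0 by (intro sum_nonneg) simp
  have G0: "G \<ge> 0" using B0 by (simp add: G_def)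
  have XN: "norm (X k) \<le> N" for k
    unfolding N_def by (rule norm_matrix_le_entries[OF R(1)])
  have ZN: "norm (consensus x :: real^'n^'n) \<le> N" if "x \<in> joint_actions \<Omega>" for x
    unfolding N_def using that
    by (intro norm_matrix_le_entries) (auto simp: consensus_def joint_actions_def intro: R(3))
  have XG: "norm (gradient_matrix J (X k)) \<le> G" for k
    unfolding G_def by (rule norm_gradient_matrix_le[OF B0 R(1)])
  have hatG: "norm (gradient_matrix J (Xhat k)) \<le> G" for k
    unfolding G_def by (rule norm_gradient_matrix_le[OF B0 R(2)])

  define c where "c k = \<theta> k * \<alpha> k" for k
  have c_eq: "c k = A / (real k + 1) powr (a + b)" for k
    by (simp add: c_def \<theta> \<alpha> powr_add mult.commute)
  have c_pos: "0 < c k" for k using A_pos by (simp add: c_eq)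
  have c_dec: "c (Suc k) \<le> c k" for k
    unfolding c_eq using A_pos exponents by (intro divide_left_mono powr_mono2) auto
  \<comment> \<open>The exponent \<open>a + b\<close> of \<open>\<mu>\<close> is that of the product
    \<open>\<theta> k * \<alpha> k\<close>.\<close>
  have \<mu>_eq: "\<mu> k = c k / c (k - 1)" if "k \<ge> 1" for k
    using that A_pos by (simp add: \<mu> c_eq powr_divide of_nat_diff)
  have \<mu>_bounds: "0 \<le> \<mu> k" "\<mu> k \<le> 1" for k
    using exponents by (auto simp: \<mu> intro!: powr_le1)
  have \<theta>_nonneg: "0 \<le> \<theta> k" and \<theta>_le1: "\<theta> k \<le> 1" for k
    using exponents by (simp_all add: \<theta> ge_one_powr_ge_zero)
  have \<theta>_dec: "\<theta> (Suc k) \<le> \<theta> k" for k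
    unfolding \<theta> using exponents by (intro divide_left_mono powr_mono2) auto
  have \<alpha>_nonneg: "0 \<le> \<alpha> k" for k using A_pos by (simp add: \<alpha>)
  have T0: "0 \<le> T" using d by (simp add: T_def)
  have \<alpha>_sq: "(\<alpha> k)\<^sup>2 = A\<^sup>2 * real (Suc k) powr (- (2 * a))" for k
  proof -
    have "((real k + 1) powr a)\<^sup>2 = (real k + 1) powr (2 * a)"
      by (simp add: power2_eq_square powr_add[symmetric])
    then show ?thesis by (simp add: \<alpha> power_mult_distrib power_inverse powr_minus divide_inverse add.commute)
  qed
  have summable: "summable (\<lambda>k. A\<^sup>2 * (real (Suc k) powr (- (2 * a)) * T))"
  proof -
    have "summable (\<lambda>k. real k powr (- (2 * a)))"
      using exponents by (subst summable_real_powr_iff) simp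
    then have "summable (\<lambda>k. real (Suc k) powr (- (2 * a)))"
      by (subst (asm) summable_Suc_iff[symmetric])
    then show ?thesis by (intro summable_mult summable_mult2)
  qed

  \<comment> \<open>Uniform bound for the weighted sum of gaps\<close>
  have bound: "(\<Sum>k=1..K. c k * (pseudo_gradient J x \<bullet> (diag_vec (X (Suc k)) - x))) \<le> C"
    if x: "x \<in> joint_actions \<Omega>" for x K
  proof -
    let ?Z = "consensus x :: real^'n^'n"
    define D where "D k = (norm (X k - ?Z))\<^sup>2" for k
    \<comment> \<open>At \<open>k = 0\<close> truncated subtraction pairs \<open>X 0\<close> with
      \<open>Xhat 0\<close>; \<open>e 0\<close> enters only through the uniform bound on
      \<open>e\<close>.\<close>
    define V where "V k = gradient_matrix J (X k) - gradient_matrix J (Xhat (k - 1))" for k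
    define e where "e k = V k \<bullet> (X k - ?Z)" for k
    have ZS: "?Z \<in> ?S"
      using x by (simp add: estimation_set_iff consensus_def joint_actions_def)
    have VG: "norm (V k) \<le> 2 * G" for k
      using norm_triangle_ineq4[of "gradient_matrix J (X k)" "gradient_matrix J (Xhat (k - 1))"]
        XG[of k] hatG[of "k - 1"] by (simp add: V_def)
    have XZ: "norm (X k - ?Z) \<le> 2 * N" for k
      using norm_triangle_ineq4[of "X k" ?Z] XN[of k] ZN[OF x] by simp
    have e_bound: "\<bar>e k\<bar> \<le> 2 * G * (2 * N)" for k
      unfolding e_def using G0
      by (intro order_trans[OF Cauchy_Schwarz_ineq2] mult_mono VG XZ) auto
    have D_nonneg: "0 \<le> D k" for k by (simp add: D_def)
    have per_step: "c k * (pseudo_gradient J x \<bullet> (diag_vec (X (Suc k)) - x))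
        \<le> \<theta> k / 2 * (D k - D (Suc k)) + c k * e (Suc k) - c k * \<mu> k * e k + \<theta> k * ((\<alpha> k)\<^sup>2 * T)"
      if k: "k \<ge> 1" for k
      unfolding c_def T_def
    proof (rule step_estimate)
      let ?m = "consensus (column_mean (X k)) :: real^'n^'n"
      let ?r = "norm (X (Suc k) - Xhat k)" and ?u = "norm (X k - ?m)"
      let ?G = "gradient_matrix J (Xhat k) + \<mu> k *\<^sub>R V k"
      have "(Xhat k - \<alpha> k *\<^sub>R ?G - X (Suc k)) \<bullet> (?Z - X (Suc k)) \<le> 0"
        unfolding step[OF k] V_def
        by (rule closest_point_dot[OF convex_estimation_set[OF action_sets(1)]
              closed_estimation_set[OF action_sets(2)] ZS])
      from projected_step[OF this] mixing_step[OF mixing d(2), of "X k" x]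
      show "D (Suc k) + ?r\<^sup>2 + 2 * \<alpha> k * (?G \<bullet> (X (Suc k) - ?Z)) \<le> D k - d * ?u\<^sup>2"
        by (simp add: D_def hat)
      \<comment> \<open>The gradient at \<open>Xhat k\<close> is traded for the one at
        \<open>X (Suc k)\<close> at the cost of \<open>V (Suc k)\<close>; pairing \<open>V k\<close>
        with \<open>X k - ?Z\<close> instead leaves the movement
        \<open>X (Suc k) - X k\<close>.\<close>
      show "?G \<bullet> (X (Suc k) - ?Z) = gradient_matrix J (X (Suc k)) \<bullet> (X (Suc k) - ?Z) - e (Suc k)
          + \<mu> k * e k + \<mu> k * (V k \<bullet> (X (Suc k) - X k))"
        by (simp add: e_def V_def[of "Suc k"] algebra_simps)
      \<comment> \<open>The mean of the old iterate is also the reference for the new one, so all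
        errors reduce to \<open>?r\<close> and \<open>?u\<close>.\<close>
      have WUm: "Xhat k - ?m = W ** (X k - ?m)"
        by (simp add: hat matrix_diff_ldistrib matrix_mult_consensus[OF mixing])
      have hat_m: "norm (Xhat k - ?m) \<le> ?u"
        unfolding WUm by (rule norm_mixing_le[OF mixing])
      have "norm (X (Suc k) - X k) \<le> ?r + norm (Xhat k - ?m) + ?u"
        using norm_triangle_ineq[of "X (Suc k) - Xhat k" "Xhat k - X k"]
          norm_triangle_ineq4[of "Xhat k - ?m" "X k - ?m"] by simp
      then have "norm (X (Suc k) - X k) \<le> ?r + 2 * ?u" using hat_m by simp
      then show "\<bar>V k \<bullet> (X (Suc k) - X k)\<bar> \<le> 2 * G * (?r + 2 * ?u)"
        using G0 by (intro order_trans[OF Cauchy_Schwarz_ineq2] mult_mono VG) auto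
      have "norm (X (Suc k) - ?m) \<le> ?r + ?u"
        using norm_triangle_ineq[of "X (Suc k) - Xhat k" "Xhat k - ?m"] hat_m by simp
      then have "Q * norm (X (Suc k) - ?m) \<le> Q * (?r + ?u)"
        using Q0 by (intro mult_left_mono) auto
      moreover have "\<bar>X (Suc k) $ i $ i - x $ i\<bar> \<le> 2 * R" for i
        using R(1)[of "Suc k" i i] R(3)[of "x $ i" i] x by (simp add: joint_actions_def)
      then have "pseudo_gradient J x \<bullet> (diag_vec (X (Suc k)) - x)
          \<le> gradient_matrix J (X (Suc k)) \<bullet> (X (Suc k) - ?Z) + Q * norm (X (Suc k) - ?m)"
        unfolding Q_def
        by (rule gap_le_estimated_gap[OF F_monotone lipschitz_nonneg(2) lipschitz_others XS[OF k]])
      ultimately show "pseudo_gradient J x \<bullet> (diag_vec (X (Suc k)) - x)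
          \<le> gradient_matrix J (X (Suc k)) \<bullet> (X (Suc k) - ?Z) + Q * (?r + ?u)"
        by linarith
    qed (use \<mu>_bounds \<alpha>_nonneg \<theta>_nonneg G0 Q0 d(1) in auto)
    have "(\<Sum>k=1..K. c k * (pseudo_gradient J x \<bullet> (diag_vec (X (Suc k)) - x)))
        \<le> \<theta> 1 / 2 * D 1 + 3 * (2 * G * (2 * N)) * c 0 + (\<Sum>k=1..K. \<theta> k * ((\<alpha> k)\<^sup>2 * T))"
      by (rule telescoped_sum_bound[where \<theta> = \<theta> and \<mu> = \<mu> and c = c and D = D and e = e,
            OF per_step c_pos c_dec \<mu>_eq \<theta>_nonneg \<theta>_dec D_nonneg e_bound])
    also have "\<dots> \<le> C"
    proof -
      have "\<theta> 1 / 2 * D 1 \<le> 1 * (2 * N)\<^sup>2"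
        unfolding D_def using \<theta>_le1[of 1] \<theta>_nonneg[of 1] XZ[of 1]
        by (intro mult_mono power_mono) auto
      moreover have "c 0 = A" by (simp add: c_eq)
      moreover have "(\<Sum>k=1..K. \<theta> k * ((\<alpha> k)\<^sup>2 * T))
          \<le> (\<Sum>k=1..K. A\<^sup>2 * (real (Suc k) powr (- (2 * a)) * T))"
      proof (rule sum_mono)
        fix k
        have "\<theta> k * ((\<alpha> k)\<^sup>2 * T) \<le> 1 * ((\<alpha> k)\<^sup>2 * T)"
          using \<theta>_le1 T0 by (intro mult_right_mono) auto
        then show "\<theta> k * ((\<alpha> k)\<^sup>2 * T) \<le> A\<^sup>2 * (real (Suc k) powr (- (2 * a)) * T)"
          by (simp add: \<alpha>_sq mult.assoc)
      qed
      moreover have "\<dots> \<le> (\<Sum>k. A\<^sup>2 * (real (Suc k) powr (- (2 * a)) * T))"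
        using T0 by (intro sum_le_suminf summable) auto
      ultimately show ?thesis by (simp add: C_def)
    qed
    finally show ?thesis .
  qed

  \<comment> \<open>From the weighted sum to the averaged action\<close>
  define w where "w = weighted_average \<theta> \<alpha> X"
  define s where "s k = (\<Sum>t=1..k. c t)" for k
  have s_lower: "A / 2 * (real k + 1) powr (1 - a - b) \<le> s k" if k: "k \<ge> 1" for k
  proof -
    have "(real k + 1) powr (1 - a - b) = (real k + 1) / (real k + 1) powr (a + b)"
      using powr_diff[of "real k + 1" 1 "a + b"] by (simp add: diff_diff_eq)
    then have "A / 2 * (real k + 1) powr (1 - a - b) = (real k + 1) / 2 * c k"
      by (simp add: c_eq)
    \<comment> \<open>\<open>k \<ge> 1\<close> gives \<open>(k + 1) / 2 \<le> k\<close>; as the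
      weights decrease, each of the \<open>k\<close> summands of \<open>s k\<close> is at least
      \<open>c k\<close>.\<close>
    also have "\<dots> \<le> real k * c k"
      using k c_pos[of k] by (intro mult_right_mono) auto
    also have "\<dots> = (\<Sum>t=1..k. c k)" by simp
    also have "\<dots> \<le> s k"
      unfolding s_def using decseqD[OF decseq_SucI[of c, OF c_dec]] by (intro sum_mono) auto
    finally show ?thesis .
  qed
  have s_pos: "0 < s k" if "k \<ge> 1" for k
    unfolding s_def using that c_pos by (intro sum_pos) auto
  have w_eq: "w k = (\<Sum>t=1..k. c t *\<^sub>R diag_vec (X (Suc t))) /\<^sub>R s k" for k
    by (simp add: w_def weighted_average_def c_def s_def)
  have w_gap: "pseudo_gradient J x \<bullet> (w k - x) \<le> C / s k"
    if x: "x \<in> joint_actions \<Omega>" and k: "k \<ge> 1" for x k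
  proof -
    have "s k *\<^sub>R (w k - x) = (\<Sum>t=1..k. c t *\<^sub>R (diag_vec (X (Suc t)) - x))"
      using s_pos[OF k] by (simp add: w_eq scaleR_diff_right sum_subtractf scaleR_sum_left s_def)
    then have "s k * (pseudo_gradient J x \<bullet> (w k - x))
        = (\<Sum>t=1..k. c t * (pseudo_gradient J x \<bullet> (diag_vec (X (Suc t)) - x)))"
      by (metis (no_types, lifting) inner_scaleR_right inner_sum_right sum.cong)
    also have "\<dots> \<le> C" by (rule bound[OF x])
    finally show ?thesis using s_pos[OF k] by (simp add: field_simps)
  qed
  \<comment> \<open>The average runs over \<open>X 2\<close> to \<open>X (k + 1)\<close>, hence over
    projected iterates only.\<close>
  have w_in: "w k \<in> joint_actions \<Omega>" if k: "k \<ge> 1" for k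
  proof -
    have "(\<Sum>t=1..k. (c t / s k) *\<^sub>R diag_vec (X (Suc t))) \<in> joint_actions \<Omega>"
    proof (rule convex_sum)
      show "convex (joint_actions \<Omega>)" by (rule convex_joint_actions[OF action_sets(1)])
      show "(\<Sum>t=1..k. c t / s k) = 1"
        using s_pos[OF k] by (simp add: sum_divide_distrib[symmetric] s_def)
      show "0 \<le> c t / s k" for t
        using c_pos[of t] s_pos[OF k] by simp
      show "diag_vec (X (Suc t)) \<in> joint_actions \<Omega>" if "t \<in> {1..k}" for t
        using XS[of t] that by (simp add: estimation_set_def)
    qed simp
    then show ?thesis
      by (simp add: w_eq scaleR_sum_right divide_inverse mult.commute)
  qed

  \<comment> \<open>Attainment of the maximum and its rate\<close>
  have compact: "compact (joint_actions \<Omega>)"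
  proof (rule compact_eq_bounded_closed[THEN iffD2, OF conjI])
    have "norm x \<le> ?n * R" if "x \<in> joint_actions \<Omega>" for x
    proof -
      have "norm x \<le> (\<Sum>i\<in>UNIV. \<bar>x $ i\<bar>)" by (rule norm_le_l1_cart)
      also have "\<dots> \<le> ?n * R"
        using that R(3) by (intro sum_bounded_above) (auto simp: joint_actions_def)
      finally show ?thesis .
    qed
    then show "bounded (joint_actions \<Omega>)" by (auto simp: bounded_iff)
    show "closed (joint_actions \<Omega>)" by (rule closed_joint_actions[OF action_sets(2)])
  qed
  have "\<exists>x\<in>joint_actions \<Omega>. \<forall>y\<in>joint_actions \<Omega>.
      pseudo_gradient J y \<bullet> (w k - y) \<le> pseudo_gradient J x \<bullet> (w k - x)" for k
  proof (rule continuous_attains_sup[OF compact])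
    show "joint_actions \<Omega> \<noteq> {}" using w_in[of 1] by auto
    show "continuous_on (joint_actions \<Omega>) (\<lambda>x. pseudo_gradient J x \<bullet> (w k - x))"
      by (intro continuous_intros
          continuous_on_pseudo_gradient[OF lipschitz_nonneg lipschitz_own lipschitz_others])
  qed
  then obtain z where z: "\<And>k. z k \<in> joint_actions \<Omega>"
    "\<And>k y. y \<in> joint_actions \<Omega> \<Longrightarrow>
      pseudo_gradient J y \<bullet> (w k - y) \<le> pseudo_gradient J (z k) \<bullet> (w k - z k)"
    by metis
  define gap where "gap k = pseudo_gradient J (z k) \<bullet> (w k - z k)" for k
  \<comment> \<open>Testing the maximum at \<open>w k\<close> itself gives the value 0. The sign
    turns the upper bound on the gap into one on its modulus, as the O-estimate demands.\<close>
  have gap0: "0 \<le> gap k" if "k \<ge> 1" for k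
    using z(2)[OF w_in[OF that], of k] by (simp add: gap_def)
  have gap_le: "gap k \<le> (2 * C / A) * (1 / (real k + 1) powr (1 - a - b))" if k: "k \<ge> 1" for k
  proof -
    have le: "gap k \<le> C / s k" unfolding gap_def by (rule w_gap[OF z(1) k])
    \<comment> \<open>The sign of \<open>C\<close> is read off from the gap; it allows replacing
      \<open>s k\<close> by its lower bound in the denominator.\<close>
    then have "0 \<le> C / s k" using gap0[OF k] by linarith
    then have C0: "0 \<le> C" using s_pos[OF k] by (simp add: zero_le_divide_iff)
    have "C / s k \<le> C / (A / 2 * (real k + 1) powr (1 - a - b))"
      using s_lower[OF k] s_pos[OF k] C0 A_pos by (intro divide_left_mono) auto
    with le show ?thesis by (simp add: mult.commute)
  qed
  have "gap \<in> O(\<lambda>k. 1 / (real k + 1) powr (1 - a - b))"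
  proof (rule bigoI)
    show "\<forall>\<^sub>F k in sequentially.
        norm (gap k) \<le> (2 * C / A) * norm (1 / (real k + 1) powr (1 - a - b))"
      using eventually_ge_at_top[of 1]
    proof eventually_elim
      case (elim k)
      have "norm (gap k) = gap k"
        "norm (1 / (real k + 1) powr (1 - a - b)) = 1 / (real k + 1) powr (1 - a - b)"
        using gap0[OF elim] by simp_all
      then show ?case using gap_le[OF elim] by (simp only:)
    qed
  qed
  moreover have "\<exists>x\<in>joint_actions \<Omega>. gap k = pseudo_gradient J x \<bullet> (weighted_average \<theta> \<alpha> X k - x)" for k
    using z(1)[of k] by (intro bexI[of _ "z k"]) (simp_all add: gap_def w_def)
  moreover have "pseudo_gradient J x \<bullet> (weighted_average \<theta> \<alpha> X k - x) \<le> gap k"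
    if "x \<in> joint_actions \<Omega>" for x k
    using z(2)[OF that, of k] by (simp add: gap_def w_def)
  ultimately show ?thesis
    by (intro exI[of _ gap] conjI allI impI ballI)
qed

end
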